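(* For every $\alpha>0$ there is some $k_0$ such that for all integers $k\geq k_0$, every finite simple graph with at least one vertex and minimum degree at least $k+k^{\frac12+\alpha}$ has a $(k+1)$-edge-connected subgraph.
   Context: A graph $H$ is $(k+1)$-edge-connected if it has at least two vertices and for every partition of $V(H)$ into two nonempty sets, at least $k+1$ edges join the two sets. *)

theory Defs
  imports Complex_Main
begin

text \<open>A simple graph is given by its vertex set and its edge set, an edge being the
  two-element set of its ends.\<close>

definition simple_graph :: "'a set \<Rightarrow> 'a set set \<Rightarrow> bool" where
  "simple_graph V E \<longleftrightarrow> (\<forall>e\<in>E. e \<subseteq> V \<and> card e = 2)"

definition degree :: "'a set set \<Rightarrow> 'a \<Rightarrow> nat" where
  "degree E v = card {e \<in> E. v \<in> e}"

text \<open>Only meaningful for finite nonempty \<open>V\<close>.\<close>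

definition min_degree :: "'a set \<Rightarrow> 'a set set \<Rightarrow> nat" where
  "min_degree V E = Min (degree E ` V)"

definition subgraph :: "'a set \<Rightarrow> 'a set set \<Rightarrow> 'a set \<Rightarrow> 'a set set \<Rightarrow> bool" where
  "subgraph W F V E \<longleftrightarrow> simple_graph W F \<and> W \<subseteq> V \<and> F \<subseteq> E"

definition joining_edges :: "'a set set \<Rightarrow> 'a set \<Rightarrow> 'a set \<Rightarrow> 'a set set" where
  "joining_edges E A B = {e \<in> E. \<exists>a\<in>A. \<exists>b\<in>B. e = {a, b}}"

text \<open>Intended for finite graphs, since \<^const>\<open>card\<close> is 0 on infinite sets.\<close>

definition edge_connected :: "nat \<Rightarrow> 'a set \<Rightarrow> 'a set set \<Rightarrow> bool" where
  "edge_connected m V E \<longleftrightarrow>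
     card V \<ge> 2 \<and>
     (\<forall>A B. A \<noteq> {} \<longrightarrow> B \<noteq> {} \<longrightarrow> A \<inter> B = {} \<longrightarrow> A \<union> B = V \<longrightarrow>
        card (joining_edges E A B) \<ge> m)"

end

theory Submission imports Defs "HOL-Analysis.Convex" begin

text \<open>Suppose that every vertex set with at least two elements has a cut with at most \<open>k\<close> edges,
  and follow a descending chain of such cuts, starting with \<open>V\<close>. The current set is \<open>X\<close>, and
  \<open>P\<close> collects the vertices that were peeled off in pieces of size at most \<open>k\<close>. When both sides
  of the cut are larger than \<open>k\<close>, only one of them is pursued and the other is forgotten.
  The potential of \<open>X\<close> adds a multiple of the number of edges from \<open>X\<close> to forgotten vertices to
  the sum of \<open>d\<^sub>X(p)\<^sup>q\<close> over \<open>p\<close> in \<open>P\<close>, for a small positive \<open>q\<close>. At a cut into two large sides,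
  concavity of \<open>x\<^sup>q\<close> makes the smaller of the two potentials at most \<open>2\<^sup>-\<^sup>q\<close> times the old one plus
  a constant, so the potential stays bounded along the chain. If \<open>s = k\<^sup>1\<^sup>/\<^sup>2\<^sup>+\<^sup>\<alpha>\<close> and \<open>q \<le> \<alpha>\<close>,
  the bound is below \<open>s/2\<close>. Since every \<open>p\<close> with a neighbour in \<open>X\<close> contributes at least 1, a vertex
  of \<open>X\<close> has at most \<open>s/2\<close> neighbours in \<open>P\<close>; hence a peeled piece uses up many edges to
  forgotten vertices, and peeling does not increase the potential. The chain can never reach
  a set of size about \<open>k/2\<close> to \<open>k\<close>, as such a set sends too many edges to forgotten vertices.\<close>

text \<open>This is midpoint concavity of \<open>x powr q\<close>, obtained from convexity of the
  power \<open>1/q\<close> at the points \<open>x powr q\<close> and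
  \<open>y powr q\<close>.\<close>

lemma powr_add_le:
  fixes x y q :: real
  assumes "0 \<le> x" "0 \<le> y" "0 < q" "q \<le> 1"
  shows "x powr q + y powr q \<le> 2 * 2 powr (- q) * (x + y) powr q"
proof -
  have two: "1 \<le> 2 * 2 powr (- q)"
    using assms powr_mono[of "-1" "-q" "2::real"] by (simp add: powr_minus)
  show ?thesis
  proof (cases "x = 0 \<or> y = 0")
    case True
    then show ?thesis
      using mult_right_mono[OF two, of "(x + y) powr q"] by auto
  next
    case False
    define a b where "a = x powr q" and "b = y powr q"
    have pos: "0 < a" "0 < b" using False assms by (auto simp: a_def b_def)
    have inv: "a powr (1/q) = x" "b powr (1/q) = y"
      using assms False by (auto simp: a_def b_def powr_powr)
    have "((1 - 1/2) *\<^sub>R a + (1/2) *\<^sub>R b) powr (1/q)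
        \<le> (1 - 1/2) * a powr (1/q) + (1/2) * b powr (1/q)"
      by (rule convex_onD[OF powr_convex]) (use assms pos in auto)
    then have "((a + b) / 2) powr (1/q) \<le> (x + y) / 2"
      by (simp add: inv field_simps)
    then have "(((a + b) / 2) powr (1/q)) powr q \<le> ((x + y) / 2) powr q"
      using assms by (intro powr_mono2) auto
    then have "(a + b) / 2 \<le> ((x + y) / 2) powr q"
      using assms pos by (simp add: powr_powr)
    also have "\<dots> = 2 powr (- q) * (x + y) powr q"
      using assms by (simp add: powr_divide powr_minus field_simps)
    finally show ?thesis by (simp add: a_def b_def)
  qed
qed

section \<open>Counting edges between vertex sets\<close>

definition degree_into :: "'a set set \<Rightarrow> 'a \<Rightarrow> 'a set \<Rightarrow> nat" where
  "degree_into E v B = card {b \<in> B. {v, b} \<in> E}"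

text \<open>Ordered pairs are counted, which makes this additive over disjoint finite unions in each
  argument; for disjoint finite sets it is the number of joining edges.\<close>

definition edge_count :: "'a set set \<Rightarrow> 'a set \<Rightarrow> 'a set \<Rightarrow> nat" where
  "edge_count E A B = (\<Sum>a\<in>A. degree_into E a B)"

lemma degree_into_Un:
  assumes "finite B" "finite C" "B \<inter> C = {}"
  shows "degree_into E v (B \<union> C) = degree_into E v B + degree_into E v C"
proof -
  have "{b \<in> B \<union> C. {v, b} \<in> E} = {b \<in> B. {v, b} \<in> E} \<union> {b \<in> C. {v, b} \<in> E}" by auto
  then show ?thesis
    unfolding degree_into_def using assms by (simp add: card_Un_disjoint disjoint_iff)
qed

lemma edge_count_Un_right:
  assumes "finite B" "finite C" "B \<inter> C = {}"
  shows "edge_count E A (B \<union> C) = edge_count E A B + edge_count E A C"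
  unfolding edge_count_def by (simp add: degree_into_Un[OF assms] sum.distrib)

lemma edge_count_Un_left:
  assumes "finite A" "finite B" "A \<inter> B = {}"
  shows "edge_count E (A \<union> B) C = edge_count E A C + edge_count E B C"
  unfolding edge_count_def using assms by (simp add: sum.union_disjoint)

lemma edge_count_commute:
  assumes "finite A" "finite B"
  shows "edge_count E A B = edge_count E B A"
proof -
  have "edge_count E A B = (\<Sum>a\<in>A. \<Sum>b\<in>B. if {a, b} \<in> E then 1 else 0)"
    unfolding edge_count_def degree_into_def using assms by (simp flip: sum.inter_filter)
  also have "\<dots> = (\<Sum>b\<in>B. \<Sum>a\<in>A. if {b, a} \<in> E then 1 else 0)"
    by (subst sum.swap) (simp add: insert_commute)
  also have "\<dots> = edge_count E B A"
    unfolding edge_count_def degree_into_def using assms by (simp flip: sum.inter_filter)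
  finally show ?thesis .
qed

lemma card_joining_edges:
  assumes "finite A" "finite B" "A \<inter> B = {}"
  shows "card (joining_edges E A B) = edge_count E A B"
proof -
  let ?S = "SIGMA a:A. {b \<in> B. {a, b} \<in> E}"
  have "joining_edges E A B = (\<lambda>(a, b). {a, b}) ` ?S"
    unfolding joining_edges_def by (auto simp: image_iff)
  moreover have "inj_on (\<lambda>(a, b). {a, b}) ?S"
    using assms(3) by (fastforce simp: inj_on_def doubleton_eq_iff)
  ultimately have "card (joining_edges E A B) = card ?S"
    by (simp add: card_image)
  then show ?thesis
    using assms by (simp add: edge_count_def degree_into_def)
qed

lemma degree_eq_degree_into:
  assumes "simple_graph V E"
  shows "degree E v = degree_into E v V"
proof -
  have "{e \<in> E. v \<in> e} = (\<lambda>u. {v, u}) ` {u \<in> V. {v, u} \<in> E}"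
  proof (intro equalityI subsetI)
    fix e assume e: "e \<in> {e \<in> E. v \<in> e}"
    then have "card e = 2" "e \<subseteq> V" using assms by (auto simp: simple_graph_def)
    then obtain u where "e = {v, u}"
      using e by (auto simp: card_2_iff)
    then show "e \<in> (\<lambda>u. {v, u}) ` {u \<in> V. {v, u} \<in> E}"
      using e \<open>e \<subseteq> V\<close> by auto
  qed auto
  moreover have "inj_on (\<lambda>u. {v, u}) {u \<in> V. {v, u} \<in> E}"
    by (auto simp: inj_on_def doubleton_eq_iff)
  ultimately show ?thesis
    unfolding degree_def degree_into_def by (simp add: card_image)
qed

lemma degree_into_less:
  assumes "simple_graph V E" "finite A" "v \<in> A"
  shows "degree_into E v A \<le> card A - 1"
proof -
  have "{v, v} \<notin> E" using assms(1) by (auto simp: simple_graph_def)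
  then have "{b \<in> A. {v, b} \<in> E} \<subseteq> A - {v}" by auto
  then have "degree_into E v A \<le> card (A - {v})"
    unfolding degree_into_def using assms(2) by (intro card_mono) auto
  then show ?thesis using assms(2,3) by simp
qed

text \<open>Collects what holds for a counterexample with excess degree \<open>s\<close>. Here
  \<open>s_sq\<close> yields \<open>limit \<le> s / 2\<close>, and \<open>s_ge\<close> excludes
  admissible sets of medium size.\<close>

locale small_cuts =
  fixes V :: "'a set" and E :: "'a set set" and k :: nat and s q :: real
  assumes finite: "finite V"
    and simple: "simple_graph V E"
    and cut: "\<And>X. X \<subseteq> V \<Longrightarrow> 2 \<le> card X \<Longrightarrow>
      \<exists>A B. A \<noteq> {} \<and> B \<noteq> {} \<and> A \<inter> B = {} \<and> A \<union> B = X \<and> edge_count E A B \<le> k"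
    and deg: "\<And>v. v \<in> V \<Longrightarrow> k + s \<le> degree_into E v V"
    and q: "0 < q" "q \<le> 1"
    and k: "1 \<le> k"
    and s_ge: "4 / (1 - 2 powr (- q)) \<le> s"
    and s_sq: "4 * (k * k powr q) / (1 - 2 powr (- q)) \<le> s * s"
begin

section \<open>The potential and its bound\<close>

definition boundary :: "'a set \<Rightarrow> 'a set \<Rightarrow> nat" where
  "boundary X P = edge_count E X (V - X - P)"

text \<open>Peeling a vertex removes at least \<open>s/2\<close> boundary edges and adds at most \<open>k\<^sup>q\<close> to the
  trace; this weight of a boundary edge balances the two.\<close>

definition lam :: real where
  "lam = 2 * k powr q / s"

definition trace :: "'a set \<Rightarrow> 'a set \<Rightarrow> real" where
  "trace X P = (\<Sum>p\<in>P. real (degree_into E p X) powr q)"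

definition potential :: "'a set \<Rightarrow> 'a set \<Rightarrow> real" where
  "potential X P = lam * boundary X P + trace X P"

definition gap :: real where
  "gap = 1 - 2 powr (- q)"

text \<open>The fixed point of \<open>x \<mapsto> 2\<^sup>-\<^sup>q x + lam k\<close>, the recursion for the potential at a large cut.\<close>

definition limit :: real where
  "limit = lam * k / gap"

text \<open>The invariant kept along the chain; \<open>V - X - P\<close> is the set of forgotten
  vertices.\<close>

definition admissible :: "'a set \<Rightarrow> 'a set \<Rightarrow> bool" where
  "admissible X P \<longleftrightarrow> X \<subseteq> V \<and> P \<subseteq> V \<and> X \<inter> P = {} \<and> potential X P \<le> limit"

lemma gap_pos: "0 < gap"
  unfolding gap_def using q powr_less_mono[of "-q" 0 "2::real"] by simp

lemma s_pos: "0 < s"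
proof -
  have "0 < 4 / gap" using gap_pos by simp
  then show ?thesis using s_ge unfolding gap_def by linarith
qed

lemma lam_pos: "0 < lam"
  unfolding lam_def using s_pos k by simp

lemma limit_le: "limit \<le> s / 2"
proof -
  have "limit = (4 * (k * k powr q) / gap) / (2 * s)"
    unfolding limit_def lam_def using s_pos gap_pos by (simp add: field_simps)
  also have "\<dots> \<le> (s * s) / (2 * s)"
    using s_sq s_pos by (intro divide_right_mono) (auto simp: gap_def)
  finally show ?thesis using s_pos by simp
qed

lemma limit_fixed: "2 powr (- q) * limit + lam * k = limit"
proof -
  have "gap * limit = lam * k" unfolding limit_def using gap_pos by simp
  then show ?thesis by (simp add: gap_def algebra_simps)
qed

section \<open>Consequences of a bounded potential\<close>

lemma finite_subset_V: "X \<subseteq> V \<Longrightarrow> finite X"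
  using finite finite_subset by blast

lemma trace_nonneg: "0 \<le> trace X P"
  unfolding trace_def by (intro sum_nonneg) simp

lemma boundary_le:
  assumes "admissible X P"
  shows "boundary X P \<le> k / gap"
proof -
  have "lam * boundary X P \<le> lam * (k / gap)"
    using assms trace_nonneg[of X P] by (simp add: admissible_def potential_def limit_def)
  then show ?thesis using lam_pos mult_le_cancel_left_pos by blast
qed

lemma trace_le:
  assumes "admissible X P"
  shows "trace X P \<le> s / 2"
proof -
  have "0 \<le> lam * boundary X P" using lam_pos by simp
  then show ?thesis
    using assms limit_le by (simp add: admissible_def potential_def)
qed

lemma degree_into_le_trace:
  assumes "v \<in> X" "X \<subseteq> V" "P \<subseteq> V"
  shows "degree_into E v P \<le> trace X P"
proof -
  let ?Q = "{p \<in> P. {v, p} \<in> E}"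
  have "1 \<le> real (degree_into E p X) powr q" if "p \<in> ?Q" for p
  proof -
    have "v \<in> {b \<in> X. {p, b} \<in> E}" using that assms by (simp add: insert_commute)
    then have "degree_into E p X \<noteq> 0"
      unfolding degree_into_def using finite_subset_V[OF assms(2)] by auto
    then show ?thesis using q by (simp add: ge_one_powr_ge_zero)
  qed
  then have "real (degree_into E v P) \<le> (\<Sum>p\<in>?Q. real (degree_into E p X) powr q)"
    unfolding degree_into_def[of E v] using sum_mono[of ?Q "\<lambda>_. 1::real"] by auto
  also have "\<dots> \<le> trace X P"
    unfolding trace_def using finite_subset_V[OF assms(3)] by (intro sum_mono2) auto
  finally show ?thesis .
qed

text \<open>A vertex of \<open>A\<close> has at most \<open>card A - 1\<close> neighbours in
  \<open>A\<close> and at most \<open>s / 2\<close> in \<open>P\<close>; the rest of its at least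
  \<open>k + s\<close> neighbours lie in \<open>B\<close> or are forgotten.\<close>

lemma edge_count_out_ge:
  assumes adm: "admissible X P" and AB: "A \<union> B = X" "A \<inter> B = {}"
  shows "card A * (k + s / 2 - card A + 1) - edge_count E A B \<le> edge_count E A (V - X - P)"
proof -
  let ?R = "V - X - P"
  have sub: "X \<subseteq> V" "P \<subseteq> V" "X \<inter> P = {}" using adm by (auto simp: admissible_def)
  then have fin: "finite A" "finite B" "finite P" "finite ?R"
    using AB finite_subset_V by (auto intro: finite)
  have V: "A \<union> B \<union> P \<union> ?R = V" using sub AB by auto
  have dis: "(A \<union> B) \<inter> P = {}" "(A \<union> B \<union> P) \<inter> ?R = {}" using sub AB by auto
  have "k + s / 2 - card A + 1 \<le> real (degree_into E v B) + degree_into E v ?R" if v: "v \<in> A" for v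
  proof -
    have "degree_into E v V
        = degree_into E v A + degree_into E v B + degree_into E v P + degree_into E v ?R"
      using degree_into_Un[OF _ fin(4) dis(2), of E v] degree_into_Un[OF _ fin(3) dis(1), of E v]
        degree_into_Un[OF fin(1,2) AB(2), of E v] fin V by simp
    moreover have "k + s \<le> degree_into E v V" using deg v AB sub by auto
    moreover have "real (degree_into E v A) \<le> real (card A) - 1"
      using degree_into_less[OF simple fin(1) v] v fin(1) by (cases "card A") auto
    moreover have "real (degree_into E v P) \<le> s / 2"
      using degree_into_le_trace[of v X P] trace_le[OF adm] v AB sub by auto
    ultimately show ?thesis by simp
  qed
  then have "(\<Sum>v\<in>A. k + s / 2 - card A + 1)
      \<le> (\<Sum>v\<in>A. real (degree_into E v B) + degree_into E v ?R)"
    by (rule sum_mono)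
  then show ?thesis
    unfolding edge_count_def by (simp add: sum.distrib)
qed

section \<open>How the two kinds of cuts change the potential\<close>

lemma admissible_split:
  assumes adm: "admissible X P" and AB: "A \<union> B = X" "A \<inter> B = {}"
    and small: "edge_count E A B \<le> k"
  shows "admissible A P \<or> admissible B P"
proof -
  let ?R = "V - X - P"
  have sub: "X \<subseteq> V" "P \<subseteq> V" "X \<inter> P = {}" using adm by (auto simp: admissible_def)
  then have fin: "finite A" "finite B" "finite P" "finite ?R"
    using AB finite_subset_V by (auto intro: finite)
  have "V - A - P = B \<union> ?R" "V - B - P = A \<union> ?R" using sub AB by auto
  then have "boundary A P = edge_count E A B + edge_count E A ?R"
    "boundary B P = edge_count E A B + edge_count E B ?R"
    unfolding boundary_def using fin AB edge_count_commute[of A B]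
    by (auto simp: edge_count_Un_right disjoint_iff)
  moreover have "boundary X P = edge_count E A ?R + edge_count E B ?R"
    unfolding boundary_def using edge_count_Un_left[OF fin(1,2) AB(2)] AB by auto
  \<comment> \<open>A cut edge becomes a boundary edge of both sides, hence
    \<open>2 * k\<close>.\<close>
  ultimately have "real (boundary A P) + boundary B P \<le> boundary X P + 2 * k"
    using small by simp
  then have b: "lam * (real (boundary A P) + boundary B P) \<le> lam * (boundary X P + 2 * k)"
    using lam_pos by simp
  \<comment> \<open>Inflating the boundary part by this factor lets it share the factor that
    concavity gives for the trace.\<close>
  have "1 \<le> 2 * 2 powr (- q)"
    using q powr_mono[of "-1" "-q" "2::real"] by (simp add: powr_minus)
  then have b': "1 * (lam * boundary X P) \<le> 2 * 2 powr (- q) * (lam * boundary X P)"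
    using lam_pos by (intro mult_right_mono) auto
  have "trace A P + trace B P
      \<le> (\<Sum>p\<in>P. 2 * 2 powr (- q) * real (degree_into E p X) powr q)"
    unfolding trace_def sum.distrib[symmetric]
  proof (rule sum_mono)
    fix p
    have "real (degree_into E p X) = real (degree_into E p A) + degree_into E p B"
      using degree_into_Un[OF fin(1,2) AB(2)] AB by simp
    then show "real (degree_into E p A) powr q + real (degree_into E p B) powr q
        \<le> 2 * 2 powr (- q) * real (degree_into E p X) powr q"
      using powr_add_le[of "real (degree_into E p A)" "real (degree_into E p B)" q] q by simp
  qed
  then have "trace A P + trace B P \<le> 2 * 2 powr (- q) * trace X P"
    by (simp add: trace_def sum_distrib_left)
  then have "potential A P + potential B P \<le> 2 * (2 powr (- q) * potential X P + lam * k)"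
    using b b' by (simp add: potential_def algebra_simps)
  also have "\<dots> \<le> 2 * (2 powr (- q) * limit + lam * k)"
    using adm by (simp add: admissible_def)
  finally have "potential A P + potential B P \<le> 2 * limit" by (simp add: limit_fixed)
  then have "potential A P \<le> limit \<or> potential B P \<le> limit" by linarith
  then show ?thesis using sub AB by (auto simp: admissible_def)
qed

text \<open>The forgotten vertices stay the same. The boundary edges lost with \<open>A\<close>, on
  average at least \<open>s / 2\<close> per vertex, pay for the new trace terms.\<close>

lemma admissible_peel:
  assumes adm: "admissible X P" and AB: "A \<union> B = X" "A \<inter> B = {}" "A \<noteq> {}"
    and small: "edge_count E A B \<le> k" and card_A: "card A \<le> k"
  shows "admissible B (P \<union> A)"
proof -
  let ?R = "V - X - P"
  have sub: "X \<subseteq> V" "P \<subseteq> V" "X \<inter> P = {}" using adm by (auto simp: admissible_def)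
  then have fin: "finite A" "finite B" "finite P" "finite ?R"
    using AB finite_subset_V by (auto intro: finite)
  have "V - B - (P \<union> A) = ?R" using AB by auto
  then have bX: "boundary X P = edge_count E A ?R + boundary B (P \<union> A)"
    unfolding boundary_def using edge_count_Un_left[OF fin(1,2) AB(2)] AB by auto
  have "1 \<le> card A" using AB fin by (simp add: Suc_leI card_gt_0_iff)
  \<comment> \<open>Expanded, this says \<open>k \<le> card A * (k - card A + 1)\<close>, so the cut
    edges take nothing from the \<open>s / 2\<close> per vertex.\<close>
  then have "0 \<le> (real (card A) - 1) * (real k - card A)" using card_A by simp
  then have "card A * (s / 2) \<le> card A * (k + s / 2 - card A + 1) - k"
    by (simp add: algebra_simps)
  then have "card A * (s / 2) \<le> edge_count E A ?R"
    using edge_count_out_ge[OF adm AB(1,2)] small by linarith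
  then have "lam * (card A * (s / 2)) \<le> lam * edge_count E A ?R"
    by (rule mult_left_mono) (use lam_pos in simp)
  moreover have "lam * (card A * (s / 2)) = card A * k powr q"
    unfolding lam_def using s_pos by simp
  ultimately have gain: "card A * k powr q \<le> lam * edge_count E A ?R" by argo
  have "real (degree_into E a B) powr q \<le> real k powr q" if "a \<in> A" for a
  proof -
    have "degree_into E a B \<le> edge_count E A B"
      unfolding edge_count_def using that fin by (intro member_le_sum) auto
    then show ?thesis using small q by (intro powr_mono2) auto
  qed
  then have new: "trace B A \<le> card A * k powr q"
    unfolding trace_def
    using sum_bounded_above[of A "\<lambda>a. real (degree_into E a B) powr q" "real k powr q"] by simp
  have old: "trace B P \<le> trace X P"
    unfolding trace_def
  proof (rule sum_mono)
    fix p
    have "degree_into E p B \<le> degree_into E p X"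
      using degree_into_Un[OF fin(1,2) AB(2), of E p] AB by simp
    then show "real (degree_into E p B) powr q \<le> real (degree_into E p X) powr q"
      using q by (intro powr_mono2) auto
  qed
  have "trace B (P \<union> A) = trace B P + trace B A"
    unfolding trace_def using fin AB sub by (intro sum.union_disjoint) auto
  then have "potential B (P \<union> A) \<le> potential X P"
    using gain new old bX by (simp add: potential_def algebra_simps)
  then show ?thesis using adm AB by (auto simp: admissible_def)
qed

text \<open>If \<open>card X \<le> k\<close>, every vertex of \<open>X\<close> sends at least
  \<open>s / 2\<close> edges to forgotten vertices, in total more than \<open>k * s / 4\<close>,
  whereas the bounded potential allows only \<open>k / gap\<close>.\<close>

lemma admissible_not_medium:
  assumes adm: "admissible X P" and "k + 1 \<le> 2 * card X"
  shows "k < card X"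
proof (rule ccontr)
  assume "\<not> k < card X"
  then have le: "s / 2 \<le> k + s / 2 - card X + 1" by simp
  have "k / gap = k * (4 / gap) / 4" by simp
  also have "\<dots> \<le> k * s / 4"
    using s_ge by (intro divide_right_mono mult_left_mono) (auto simp: gap_def)
  also have "\<dots> < card X * (s / 2)" using assms(2) s_pos by (simp add: field_simps flip: distrib_left)
  also have "\<dots> \<le> card X * (k + s / 2 - card X + 1)" using le by (intro mult_left_mono) auto
  also have "\<dots> \<le> boundary X P"
    using edge_count_out_ge[OF adm, of X "{}"]
    by (simp add: boundary_def edge_count_def degree_into_def)
  also have "\<dots> \<le> k / gap" by (rule boundary_le[OF adm])
  finally show False by simp
qed

text \<open>Descent on \<open>card X\<close>: an admissible set larger than \<open>k\<close> would
  always contain a smaller admissible one that is again larger than \<open>k\<close>.\<close>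

lemma not_admissible: "admissible X P \<Longrightarrow> card X \<le> k"
proof (induction "card X" arbitrary: X P rule: less_induct)
  case less
  show ?case
  proof (rule ccontr)
    assume big: "\<not> card X \<le> k"
    have X: "X \<subseteq> V" "finite X" using less.prems finite_subset_V by (auto simp: admissible_def)
    have "2 \<le> card X" using big k by simp
    then obtain A B where AB: "A \<noteq> {}" "B \<noteq> {}" "A \<inter> B = {}" "A \<union> B = X"
      and small: "edge_count E A B \<le> k" using cut X by meson
    have fin: "finite A" "finite B" using AB X by auto
    have card_X: "card X = card A + card B" using AB fin card_Un_disjoint by blast
    have pos: "0 < card A" "0 < card B" using AB fin by (auto simp: card_gt_0_iff)
    have peel: False if "C \<union> D = X" "C \<inter> D = {}" "C \<noteq> {}" "edge_count E C D \<le> k" "card C \<le> k"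
      "card C \<le> card D" "card X = card C + card D" "0 < card C" for C D
    proof -
      have adm: "admissible D (P \<union> C)" using admissible_peel less.prems that by blast
      \<comment> \<open>The larger side has more than half of \<open>k\<close> vertices, and medium
        sizes are excluded.\<close>
      have "k + 1 \<le> 2 * card D" using that big by simp
      then have "k < card D" using admissible_not_medium[OF adm] by simp
      then show False using less.hyps[OF _ adm] that by simp
    qed
    have small': "edge_count E B A \<le> k" using small edge_count_commute[OF fin] by simp
    consider "card A \<le> k" "card A \<le> card B" | "card B \<le> k" "card B \<le> card A"
      | "k < card A" "k < card B" by linarith
    then show False
    proof cases
      case 1
      then show False using peel[of A B] AB small card_X pos by simp
    next
      case 2
      then show False using peel[of B A] AB small' card_X pos by (simp add: Un_commute Int_commute)
    next
      case 3
      then show False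
        using admissible_split[OF less.prems AB(4,3) small] less.hyps[of A P] less.hyps[of B P]
          card_X pos by auto
    qed
  qed
qed

text \<open>The chain starts at \<open>V\<close> with nothing peeled or forgotten, hence with
  potential 0; then \<open>card V \<le> k\<close> contradicts the degree bound.\<close>

lemma empty: "V = {}"
proof (rule ccontr)
  assume "V \<noteq> {}"
  then obtain v where v: "v \<in> V" by blast
  have "potential V {} = 0"
    by (simp add: potential_def trace_def boundary_def edge_count_def degree_into_def)
  then have "admissible V {}"
    using lam_pos gap_pos by (simp add: admissible_def limit_def)
  then have "card V \<le> k" by (rule not_admissible)
  moreover have "degree_into E v V \<le> card V"
    unfolding degree_into_def using finite by (intro card_mono) auto
  ultimately show False using deg[OF v] s_pos by simp
qed

end

section \<open>Small cuts in a counterexample, and the choice of constants\<close>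

lemma small_cut_if_not_edge_connected:
  assumes "finite V" "simple_graph V E" "X \<subseteq> V" "2 \<le> card X"
    and "\<nexists>W F. subgraph W F V E \<and> edge_connected (k + 1) W F"
  shows "\<exists>A B. A \<noteq> {} \<and> B \<noteq> {} \<and> A \<inter> B = {} \<and> A \<union> B = X \<and> edge_count E A B \<le> k"
proof -
  \<comment> \<open>The induced subgraph on \<open>X\<close> has the same edges across a cut of
    \<open>X\<close> as the whole graph.\<close>
  let ?F = "{e \<in> E. e \<subseteq> X}"
  have "subgraph X ?F V E" using assms(2,3) by (auto simp: subgraph_def simple_graph_def)
  then have "\<not> edge_connected (k + 1) X ?F" using assms(5) by blast
  then obtain A B where AB: "A \<noteq> {}" "B \<noteq> {}" "A \<inter> B = {}" "A \<union> B = X"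
    and less: "card (joining_edges ?F A B) < k + 1"
    using assms(4) by (auto simp: edge_connected_def not_le)
  have "joining_edges ?F A B = joining_edges E A B"
    using AB by (auto simp: joining_edges_def)
  moreover have "finite A" "finite B"
    using AB assms(1,3) by (metis finite_Un finite_subset)+
  ultimately have "edge_count E A B \<le> k"
    using less AB card_joining_edges[of A B E] by simp
  then show ?thesis using AB by blast
qed

theorem theorem5:
  fixes \<alpha> :: real
  assumes "\<alpha> > 0"
  shows "\<exists>k0::nat. \<forall>k::nat. k \<ge> k0 \<longrightarrow>
    (\<forall>(V::'a set) (E::'a set set).
       finite V \<longrightarrow> V \<noteq> {} \<longrightarrow> simple_graph V E \<longrightarrow>
       real (min_degree V E) \<ge> real k + real k powr (1/2 + \<alpha>) \<longrightarrow>
       (\<exists>W F. subgraph W F V E \<and> edge_connected (k + 1) W F))"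
proof -
  \<comment> \<open>Concavity uses \<open>q \<le> 1\<close>; the bound by \<open>?s * ?s\<close>
    uses \<open>q \<le> \<alpha>\<close>.\<close>
  define q where "q = min \<alpha> 1"
  have q: "0 < q" "q \<le> 1" "q \<le> \<alpha>" using assms by (auto simp: q_def)
  define C where "C = 4 / (1 - 2 powr (- q))"
  \<comment> \<open>The root makes \<open>C \<le> k powr \<alpha>\<close>; the maximum with 1 also
    forces \<open>1 \<le> k\<close>.\<close>
  define k0 where "k0 = nat \<lceil>max C 1 powr (1 / \<alpha>)\<rceil>"
  have k0: "1 \<le> k \<and> C \<le> real k powr \<alpha> \<and> C \<le> real k powr (1/2 + \<alpha>)" if "k0 \<le> k" for k
  proof -
    have le: "max C 1 powr (1 / \<alpha>) \<le> k"
      using that unfolding k0_def by linarith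
    have "1 \<le> max C 1 powr (1 / \<alpha>)"
      using assms by (intro ge_one_powr_ge_zero) auto
    then have "1 \<le> k" using le by simp
    have "C \<le> (max C 1 powr (1 / \<alpha>)) powr \<alpha>"
      using assms by (simp add: powr_powr)
    also have "\<dots> \<le> real k powr \<alpha>"
      using le assms by (intro powr_mono2) auto
    finally have "C \<le> real k powr \<alpha>" .
    moreover have "real k powr \<alpha> \<le> real k powr (1/2 + \<alpha>)"
      using \<open>1 \<le> k\<close> by (intro powr_mono) auto
    ultimately show ?thesis using \<open>1 \<le> k\<close> by simp
  qed
  show ?thesis
  proof (intro exI[of _ k0] allI impI, rule ccontr)
    fix k :: nat and V :: "'a set" and E :: "'a set set"
    assume "k0 \<le> k" and V: "finite V" "V \<noteq> {}" "simple_graph V E"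
      and min_deg: "real (min_degree V E) \<ge> real k + real k powr (1/2 + \<alpha>)"
      and none: "\<nexists>W F. subgraph W F V E \<and> edge_connected (k + 1) W F"
    let ?s = "real k powr (1/2 + \<alpha>)"
    have C: "C \<le> ?s" "C \<le> real k powr \<alpha>" "1 \<le> k" using k0[OF \<open>k0 \<le> k\<close>] by auto
    \<comment> \<open>One factor \<open>k powr \<alpha>\<close> absorbs \<open>C\<close>, the other
      \<open>k powr q\<close>.\<close>
    have "C * (k * k powr q) \<le> k powr \<alpha> * (k * k powr \<alpha>)"
      using C q by (intro mult_mono powr_mono) auto
    also have "\<dots> = k powr \<alpha> * (k powr 1 * k powr \<alpha>)" by simp
    also have "\<dots> = ?s * ?s"
      unfolding powr_add[symmetric] by (simp add: algebra_simps)
    finally have sq: "C * (k * k powr q) \<le> ?s * ?s" .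
    interpret small_cuts V E k ?s q
    proof
      show "\<exists>A B. A \<noteq> {} \<and> B \<noteq> {} \<and> A \<inter> B = {} \<and> A \<union> B = X \<and> edge_count E A B \<le> k"
        if "X \<subseteq> V" "2 \<le> card X" for X
        using small_cut_if_not_edge_connected[OF V(1,3) that none] .
      show "k + ?s \<le> degree_into E v V" if "v \<in> V" for v
      proof -
        have "min_degree V E \<le> degree E v"
          unfolding min_degree_def using V that by (intro Min_le) auto
        then show ?thesis using min_deg degree_eq_degree_into[OF V(3), of v] by simp
      qed
    qed (use V q C sq in \<open>auto simp: C_def\<close>)
    show False using empty V by simp
  qed
qed

end
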